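(* Let $D_4=\langle a,b\mid a^4=b^2=1,\ ba=a^{-1}b\rangle$ be the dihedral group of order $8$. Let $\widetilde C'_M$ be the $\{\pm1\}$-valued function on $(\langle a^2\rangle\times D_4)\cup(D_4\times\langle a^2\rangle)$ defined by $$\widetilde C'_M(a^2,a^j)=1,\qquad \widetilde C'_M(a^2,a^jb)=-1\qquad(0\le j\le3),$$ $$\widetilde C'_M(y,a^2)=1\quad\text{and}\quad \widetilde C'_M(1,y)=\widetilde C'_M(y,1)=1\quad\text{for all }y\in D_4 .$$ Then $\widetilde C'_M$ cannot be extended to a $2$-cocycle on $D_4$ with values in $\mu_2=\{\pm1\}$.
   Context: A $2$-cocycle on a group $G$ with values in an abelian group $A$ (trivial action) is a function $c:G\times G\to A$ with $c(x,y)c(xy,z)=c(x,yz)c(y,z)$ for all $x,y,z\in G$. *)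

theory Defs
  imports "HOL-Algebra.Algebra"
begin

locale dihedral_relations = group G for G (structure) +
  fixes a b
  assumes a_closed [simp, intro]: "a \<in> carrier G"
    and b_closed [simp, intro]: "b \<in> carrier G"
    and a_pow_4: "a [^] (4::nat) = \<one>"
    and b_pow_2: "b [^] (2::nat) = \<one>"
    and b_a: "b \<otimes> a = inv a \<otimes> b"

text \<open>The group presented by these relations is characterised as the group of order 8 that is
  generated by two elements satisfying them. See \<open>dihedral_universal\<close> for the universal
  property of the presentation, and \<open>D4_model_dihedral\<close> for existence.\<close>

locale dihedral_group_8 = dihedral_relations +
  assumes generated: "carrier G = generate G {a, b}"
    and order_8: "order G = 8"

text \<open>The action of \<open>G\<close> on \<open>A\<close> is trivial; cocycles are not assumed to be normalised.\<close>

locale two_cocycle = G?: group G + A?: comm_group A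
  for G :: "('g, 'm) monoid_scheme" (structure) and A :: "('a, 'n) monoid_scheme" (structure) +
  fixes c :: "'g \<times> 'g \<Rightarrow> 'a"
  assumes closed: "c \<in> carrier G \<times> carrier G \<rightarrow> carrier A"
    and cocycle: "\<lbrakk>x \<in> carrier G; y \<in> carrier G; z \<in> carrier G\<rbrakk> \<Longrightarrow>
      c (x, y) \<otimes>\<^bsub>A\<^esub> c (x \<otimes>\<^bsub>G\<^esub> y, z) = c (x, y \<otimes>\<^bsub>G\<^esub> z) \<otimes>\<^bsub>A\<^esub> c (y, z)"

abbreviation mu2 :: "int monoid" where
  "mu2 \<equiv> sign_img"

lemma mu2_comm_group: "comm_group mu2"
  by (rule comm_groupI) (auto simp: sign_img_def)

definition CM_domain :: "('g, 'm) monoid_scheme \<Rightarrow> 'g \<Rightarrow> ('g \<times> 'g) set" where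
  "CM_domain G a =
     (generate G {a [^]\<^bsub>G\<^esub> (2::nat)} \<times> carrier G) \<union> (carrier G \<times> generate G {a [^]\<^bsub>G\<^esub> (2::nat)})"

definition D4_idx :: "(nat \<times> nat) set" where
  "D4_idx = {..<4} \<times> {..<2}"

text \<open>The pair \<open>(i, j)\<close> stands for \<open>a\<^sup>i b\<^sup>j\<close>.\<close>

definition D4_mult :: "nat \<times> nat \<Rightarrow> nat \<times> nat \<Rightarrow> nat \<times> nat" where
  "D4_mult p q = ((fst p + (if snd p = 0 then fst q else 3 * fst q)) mod 4, (snd p + snd q) mod 2)"

definition D4_model :: "(nat \<times> nat) monoid" where
  "D4_model = \<lparr>carrier = D4_idx, monoid.mult = D4_mult, one = (0, 0)\<rparr>"

lemma D4_mult_closed: "\<lbrakk>p \<in> D4_idx; q \<in> D4_idx\<rbrakk> \<Longrightarrow> D4_mult p q \<in> D4_idx"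
  by (auto simp: D4_idx_def D4_mult_def)

lemma D4_mult_assoc:
  assumes "p \<in> D4_idx" "q \<in> D4_idx" "r \<in> D4_idx"
  shows "D4_mult (D4_mult p q) r = D4_mult p (D4_mult q r)"
proof -
  obtain i j k l m n where pqr: "p = (i, j)" "q = (k, l)" "r = (m, n)" by (metis surj_pair)
  then have "j = 0 \<or> j = 1" "l = 0 \<or> l = 1" "n = 0 \<or> n = 1"
    using assms by (auto simp: D4_idx_def)
  moreover have "(i + 3 * ((k + 3 * m) mod 4)) mod 4 = (i + 3 * k + m) mod 4"
  proof -
    have "(i + 3 * ((k + 3 * m) mod 4)) mod 4 = (i + 3 * (k + 3 * m)) mod 4"
      by (metis mod_add_right_eq mod_mult_right_eq)
    also have "i + 3 * (k + 3 * m) = (i + 3 * k + m) + 2 * m * 4" by simp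
    finally show ?thesis by (simp only: mod_mult_self1)
  qed
  moreover have "(i + 3 * ((k + m) mod 4)) mod 4 = (i + 3 * k + 3 * m) mod 4"
  proof -
    have "(i + 3 * ((k + m) mod 4)) mod 4 = (i + 3 * (k + m)) mod 4"
      by (metis mod_add_right_eq mod_mult_right_eq)
    then show ?thesis by (simp add: algebra_simps)
  qed
  ultimately show ?thesis
    by (elim disjE) (simp_all add: pqr D4_mult_def mod_add_left_eq mod_add_right_eq add.assoc)
qed

lemma D4_mult_inv:
  assumes "p \<in> D4_idx"
  shows "\<exists>q\<in>D4_idx. D4_mult q p = (0, 0)"
proof (cases "snd p = 0")
  case True
  then have "D4_mult ((3 * fst p) mod 4, 0) p = (0, 0)"
    by (simp add: D4_mult_def) presburger
  then show ?thesis by (intro bexI) (auto simp: D4_idx_def)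
next
  case False
  then have "snd p = 1" using assms by (auto simp: D4_idx_def)
  then have "D4_mult p p = (0, 0)"
    by (simp add: D4_mult_def)
  then show ?thesis using assms by blast
qed

lemma D4_model_group: "group D4_model"
proof (rule groupI)
  fix p assume p: "p \<in> carrier D4_model"
  then show "\<exists>q\<in>carrier D4_model. q \<otimes>\<^bsub>D4_model\<^esub> p = \<one>\<^bsub>D4_model\<^esub>"
    using D4_mult_inv by (simp add: D4_model_def)
  from p show "\<one>\<^bsub>D4_model\<^esub> \<otimes>\<^bsub>D4_model\<^esub> p = p"
    by (cases p) (simp add: D4_model_def D4_mult_def D4_idx_def)
  fix q assume q: "q \<in> carrier D4_model"
  with p show "p \<otimes>\<^bsub>D4_model\<^esub> q \<in> carrier D4_model"
    using D4_mult_closed by (simp add: D4_model_def)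
  fix r assume "r \<in> carrier D4_model"
  with p q show "p \<otimes>\<^bsub>D4_model\<^esub> q \<otimes>\<^bsub>D4_model\<^esub> r = p \<otimes>\<^bsub>D4_model\<^esub> (q \<otimes>\<^bsub>D4_model\<^esub> r)"
    using D4_mult_assoc unfolding D4_model_def monoid.simps partial_object.simps by blast
qed (simp add: D4_model_def D4_idx_def)

context dihedral_relations
begin

lemma a_pow_mod: "a [^] n = a [^] (n mod 4)" for n :: nat
proof -
  have "a [^] n = a [^] (4 * (n div 4) + n mod 4)" by simp
  also have "\<dots> = a [^] (4 * (n div 4)) \<otimes> a [^] (n mod 4)" by (simp only: nat_pow_mult a_closed)
  also have "a [^] (4 * (n div 4)) = \<one>"
    by (simp only: nat_pow_pow [symmetric] a_closed a_pow_4 nat_pow_one)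
  finally show ?thesis by simp
qed

lemma b_pow_mod: "b [^] n = b [^] (n mod 2)" for n :: nat
proof -
  have "b [^] n = b [^] (2 * (n div 2) + n mod 2)" by simp
  also have "\<dots> = b [^] (2 * (n div 2)) \<otimes> b [^] (n mod 2)" by (simp only: nat_pow_mult b_closed)
  also have "b [^] (2 * (n div 2)) = \<one>"
    by (simp only: nat_pow_pow [symmetric] b_closed b_pow_2 nat_pow_one)
  finally show ?thesis by simp
qed

lemma inv_a: "inv a = a [^] (3::nat)"
  by (rule inv_equality) (use a_pow_4 in \<open>simp_all add: numeral_eq_Suc\<close>)

lemma b_a_pow: "b \<otimes> a [^] k = a [^] (3 * k) \<otimes> b" for k :: nat
proof (induction k)
  case (Suc k)
  have "b \<otimes> a [^] Suc k = (b \<otimes> a [^] k) \<otimes> a" by (simp add: m_assoc)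
  also have "\<dots> = a [^] (3 * k) \<otimes> (b \<otimes> a)" by (simp add: Suc m_assoc)
  also have "\<dots> = (a [^] (3 * k) \<otimes> a [^] (3::nat)) \<otimes> b"
    by (simp only: b_a inv_a m_assoc nat_pow_closed a_closed b_closed)
  also have "\<dots> = a [^] (3 * k + 3) \<otimes> b" by (simp only: nat_pow_mult a_closed)
  finally show ?case by (simp add: algebra_simps)
qed simp

definition el :: "nat \<times> nat \<Rightarrow> 'a" where
  "el p = a [^] fst p \<otimes> b [^] snd p"

lemma el_closed [simp]: "el p \<in> carrier G"
  by (simp add: el_def)

lemma el_mult:
  assumes "p \<in> D4_idx" "q \<in> D4_idx"
  shows "el p \<otimes> el q = el (D4_mult p q)"
proof -
  obtain i j k l where pq: "p = (i, j)" "q = (k, l)" by (metis surj_pair)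
  define m where "m = (if j = 0 then k else 3 * k)"
  have "j = 0 \<or> j = 1" using assms pq by (auto simp: D4_idx_def)
  then have *: "b [^] j \<otimes> a [^] k = a [^] m \<otimes> b [^] j"
    using b_a_pow[of k] by (auto simp: m_def)
  have "el p \<otimes> el q = a [^] i \<otimes> (b [^] j \<otimes> a [^] k) \<otimes> b [^] l"
    by (simp add: el_def pq m_assoc)
  also have "\<dots> = (a [^] i \<otimes> a [^] m) \<otimes> (b [^] j \<otimes> b [^] l)"
    by (simp add: * m_assoc)
  also have "\<dots> = a [^] (i + m) \<otimes> b [^] (j + l)"
    by (simp only: nat_pow_mult a_closed b_closed)
  also have "\<dots> = a [^] ((i + m) mod 4) \<otimes> b [^] ((j + l) mod 2)"
    using a_pow_mod b_pow_mod by metis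
  finally show ?thesis by (simp add: el_def pq D4_mult_def m_def)
qed

lemma generate_subset_el: "generate G {a, b} \<subseteq> el ` D4_idx"
proof
  fix g assume "g \<in> generate G {a, b}"
  then show "g \<in> el ` D4_idx"
  proof induction
    case one
    show ?case by (rule image_eqI[of _ _ "(0, 0)"]) (auto simp: el_def D4_idx_def)
  next
    case (incl h)
    have "a = el (1, 0)" "b = el (0, 1)" by (auto simp: el_def)
    then show ?case using incl by (auto simp: D4_idx_def)
  next
    case (inv h)
    have "inv b = b" using b_pow_2 by (intro inv_equality) (auto simp: numeral_2_eq_2)
    then have "inv a = el (3, 0)" "inv b = el (0, 1)" by (auto simp: el_def inv_a)
    then show ?case using inv by (auto simp: D4_idx_def)
  next
    case (eng h1 h2)
    then show ?case using el_mult D4_mult_closed by force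
  qed
qed

end

context dihedral_group_8
begin

lemma el_image: "el ` D4_idx = carrier G"
  using generate_subset_el generated by auto

lemma el_inj: "inj_on el D4_idx"
proof (rule eq_card_imp_inj_on)
  show "finite D4_idx" by (simp add: D4_idx_def)
  have "card D4_idx = 8" by (simp add: D4_idx_def)
  then show "card (el ` D4_idx) = card D4_idx"
    using order_8 unfolding el_image order_def by simp
qed

end

lemma dihedral_universal:
  assumes "dihedral_group_8 G a b" and "dihedral_relations H x y"
  shows "\<exists>h \<in> hom G H. h a = x \<and> h b = y \<and>
    (\<forall>h' \<in> hom G H. h' a = x \<and> h' b = y \<longrightarrow> (\<forall>g \<in> carrier G. h' g = h g))"
proof -
  interpret G: dihedral_group_8 G a b by fact
  interpret H: dihedral_relations H x y by fact
  define h where "h g = H.el (inv_into D4_idx G.el g)" for g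
  have h_el: "h (G.el p) = H.el p" if "p \<in> D4_idx" for p
    using that by (simp add: h_def G.el_inj)
  have hom: "h \<in> hom G H"
  proof (rule homI)
    fix g assume "g \<in> carrier G"
    show "h g \<in> carrier H" by (simp add: h_def)
  next
    fix g g' assume "g \<in> carrier G" "g' \<in> carrier G"
    then obtain p q where "p \<in> D4_idx" "q \<in> D4_idx" "g = G.el p" "g' = G.el q"
      using G.el_image by (metis imageE)
    then show "h (g \<otimes>\<^bsub>G\<^esub> g') = h g \<otimes>\<^bsub>H\<^esub> h g'"
      by (simp add: G.el_mult H.el_mult h_el D4_mult_closed)
  qed
  have ha: "h a = x"
    using h_el[of "(1, 0)"] by (simp add: G.el_def H.el_def D4_idx_def)
  have hb: "h b = y"
    using h_el[of "(0, 1)"] by (simp add: G.el_def H.el_def D4_idx_def)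
  have uniq: "h' g = h g"
    if "h' \<in> hom G H" "h' a = x" "h' b = y" and g: "g \<in> carrier G" for h' g
  proof -
    interpret h': group_hom G H h' by unfold_locales (fact that)
    obtain p where p: "p \<in> D4_idx" "g = G.el p" using G.el_image g by (metis imageE)
    show ?thesis using p that by (simp add: h_el, simp add: G.el_def H.el_def h'.hom_nat_pow)
  qed
  show ?thesis
    by (intro bexI[OF _ hom] conjI ballI impI ha hb) (elim conjE, rule uniq)
qed

lemma D4_model_dihedral: "dihedral_group_8 D4_model (1, 0) (0, 1)"
proof -
  interpret group D4_model by (rule D4_model_group)
  note defs = D4_model_def D4_mult_def D4_idx_def
  have inv_a: "inv\<^bsub>D4_model\<^esub> (1, 0) = (3, 0)"
    by (rule inv_equality) (auto simp: defs)
  have powa: "(1, 0) [^]\<^bsub>D4_model\<^esub> i = (i mod 4, 0)" for i :: nat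
    by (induction i) (simp_all add: D4_model_def D4_mult_def mod_Suc_eq)
  have powb: "(0, 1) [^]\<^bsub>D4_model\<^esub> j = (0, j mod 2)" for j :: nat
    by (induction j) (simp_all add: D4_model_def D4_mult_def mod_Suc_eq)
  interpret dihedral_relations D4_model "(1, 0)" "(0, 1)"
  proof
    show "(1, 0) [^]\<^bsub>D4_model\<^esub> (4::nat) = \<one>\<^bsub>D4_model\<^esub>"
      unfolding powa by (simp add: D4_model_def)
    show "(0, 1) [^]\<^bsub>D4_model\<^esub> (2::nat) = \<one>\<^bsub>D4_model\<^esub>"
      unfolding powb by (simp add: D4_model_def)
    show "(0, 1) \<otimes>\<^bsub>D4_model\<^esub> (1, 0) = inv\<^bsub>D4_model\<^esub> (1, 0) \<otimes>\<^bsub>D4_model\<^esub> (0, 1)"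
      unfolding inv_a by (simp add: D4_model_def D4_mult_def)
  qed (simp_all add: defs)
  have el: "el p = p" if "p \<in> D4_idx" for p
    using that unfolding el_def powa powb by (auto simp: D4_model_def D4_mult_def D4_idx_def)
  let ?S = "generate D4_model {(1, 0), (0, 1)}"
  have sub: "subgroup ?S D4_model" by (rule generate_is_subgroup) (simp add: defs)
  have pow: "x [^]\<^bsub>D4_model\<^esub> n \<in> ?S" if "x \<in> ?S" for x and n :: nat
    by (induction n)
      (use that subgroup.one_closed[OF sub] subgroup.m_closed[OF sub] in auto)
  have el_in: "el p \<in> ?S" for p
    unfolding el_def
    by (intro subgroup.m_closed[OF sub] pow generate.incl) auto
  have "carrier D4_model \<subseteq> ?S"
  proof
    fix p assume "p \<in> carrier D4_model"
    then have "el p = p" by (intro el) (simp add: D4_model_def)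
    with el_in[of p] show "p \<in> ?S" by simp
  qed
  moreover have "?S \<subseteq> carrier D4_model" using subgroup.subset[OF sub] .
  ultimately have gen: "carrier D4_model = ?S" by (rule equalityI)
  have ord: "order D4_model = 8" by (simp add: order_def defs)
  show ?thesis by unfold_locales (rule gen, rule ord)
qed

text \<open>The values prescribed on \<open>CM_domain\<close> are consistent.\<close>

lemma CM_exists:
  assumes "dihedral_group_8 G a b"
  shows "\<exists>C \<in> CM_domain G a \<rightarrow> carrier mu2.
    (\<forall>j\<le>3. C (a [^]\<^bsub>G\<^esub> (2::nat), a [^]\<^bsub>G\<^esub> (j::nat)) = 1) \<and>
    (\<forall>j\<le>3. C (a [^]\<^bsub>G\<^esub> (2::nat), a [^]\<^bsub>G\<^esub> (j::nat) \<otimes>\<^bsub>G\<^esub> b) = -1) \<and>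
    (\<forall>y\<in>carrier G. C (y, a [^]\<^bsub>G\<^esub> (2::nat)) = 1 \<and> C (\<one>\<^bsub>G\<^esub>, y) = 1 \<and> C (y, \<one>\<^bsub>G\<^esub>) = 1)"
proof -
  interpret dihedral_group_8 G a b by fact
  define B where "B = (\<lambda>j. a [^]\<^bsub>G\<^esub> j \<otimes>\<^bsub>G\<^esub> b) ` {..3::nat}"
  define C where "C p = (if fst p = a [^]\<^bsub>G\<^esub> (2::nat) \<and> snd p \<in> B then -1 else 1 :: int)" for p
  have neq: "el p \<noteq> el q" if "p \<in> D4_idx" "q \<in> D4_idx" "p \<noteq> q" for p q
    using el_inj that by (auto dest: inj_onD)
  have notin: "a [^]\<^bsub>G\<^esub> i \<notin> B" if "i \<le> 3" for i :: nat
  proof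
    assume "a [^]\<^bsub>G\<^esub> i \<in> B"
    then obtain j where "j \<le> 3" "el (i, 0) = el (j, 1)" by (auto simp: B_def el_def)
    then show False using neq[of "(i, 0)" "(j, 1)"] that by (auto simp: D4_idx_def)
  qed
  have "\<one>\<^bsub>G\<^esub> \<notin> B" using notin[of 0] by simp
  moreover have "\<one>\<^bsub>G\<^esub> \<noteq> a [^]\<^bsub>G\<^esub> (2::nat)"
    using neq[of "(0, 0)" "(2, 0)"] by (simp add: el_def D4_idx_def)
  ultimately show ?thesis
    using notin by (intro bexI[of _ C]) (auto simp: C_def B_def sign_img_def)
qed

end

theory Submission
  imports Defs
begin

text \<open>Write the central extension defined by a cocycle \<open>c\<close> as lifts \<open>s g\<close> with
  \<open>s g s h = c (g, h) s (gh)\<close>. Since \<open>aba = b\<close>, we have \<open>s a s b s a = \<epsilon> s b\<close> for a sign \<open>\<epsilon>\<close>, and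
  applying this twice gives \<open>(s a)\<^sup>2 s b (s a)\<^sup>2 = s b\<close>. As \<open>(s a)\<^sup>2\<close> is \<open>s (a\<^sup>2)\<close> up to a sign, this
  forces \<open>c (a\<^sup>2, b) c (a\<^sup>2b, a\<^sup>2) = 1\<close>, whereas the prescribed values multiply to \<open>-1\<close>.\<close>

lemma (in two_cocycle) value_closed:
  "\<lbrakk>x \<in> carrier G; y \<in> carrier G\<rbrakk> \<Longrightarrow> c (x, y) \<in> carrier A"
  using closed by auto

text \<open>Both sides are the factor of \<open>s y\<close> in the product
  \<open>s x s x s y s x s x\<close>: the left side multiplies each outer pair
  \<open>s x s x\<close> first, the right side applies \<open>s x s y s x\<close> twice.\<close>

lemma (in two_cocycle) cocycle_square_sandwich:
  assumes x: "x \<in> carrier G" and y: "y \<in> carrier G" and xyx: "x \<otimes> y \<otimes> x = y"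
  shows "(c (x, x) \<otimes>\<^bsub>A\<^esub> c (x, x)) \<otimes>\<^bsub>A\<^esub> (c (x \<otimes> x, y) \<otimes>\<^bsub>A\<^esub> c (x \<otimes> x \<otimes> y, x \<otimes> x)) =
    (c (x, y) \<otimes>\<^bsub>A\<^esub> c (x \<otimes> y, x)) \<otimes>\<^bsub>A\<^esub> (c (x, y) \<otimes>\<^bsub>A\<^esub> c (x \<otimes> y, x))"
proof -
  note [simp] = x y value_closed
  have 1: "c (x, x) \<otimes>\<^bsub>A\<^esub> c (x \<otimes> x, y) = c (x, x \<otimes> y) \<otimes>\<^bsub>A\<^esub> c (x, y)"
    by (rule cocycle) auto
  have "x \<otimes> x \<otimes> y \<otimes> x = x \<otimes> y"
    using xyx by (simp add: G.m_assoc)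
  then have 2: "c (x \<otimes> x \<otimes> y, x) \<otimes>\<^bsub>A\<^esub> c (x \<otimes> y, x) = c (x \<otimes> x \<otimes> y, x \<otimes> x) \<otimes>\<^bsub>A\<^esub> c (x, x)"
    using cocycle[of "x \<otimes> x \<otimes> y" x x] by simp
  \<comment> \<open>Enclosing \<open>s (xy)\<close> between two copies of \<open>s x\<close>
    produces the same factor as enclosing \<open>s y\<close>.\<close>
  have 3: "c (x, x \<otimes> y) \<otimes>\<^bsub>A\<^esub> c (x \<otimes> x \<otimes> y, x) = c (x, y) \<otimes>\<^bsub>A\<^esub> c (x \<otimes> y, x)"
    using cocycle[of x "x \<otimes> y" x] xyx by (simp add: G.m_assoc)
  have "(c (x, x) \<otimes>\<^bsub>A\<^esub> c (x, x)) \<otimes>\<^bsub>A\<^esub> (c (x \<otimes> x, y) \<otimes>\<^bsub>A\<^esub> c (x \<otimes> x \<otimes> y, x \<otimes> x)) =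
    (c (x, x) \<otimes>\<^bsub>A\<^esub> c (x \<otimes> x, y)) \<otimes>\<^bsub>A\<^esub> (c (x \<otimes> x \<otimes> y, x \<otimes> x) \<otimes>\<^bsub>A\<^esub> c (x, x))"
    by (simp add: A.m_ac)
  also have "\<dots> = (c (x, x \<otimes> y) \<otimes>\<^bsub>A\<^esub> c (x \<otimes> x \<otimes> y, x)) \<otimes>\<^bsub>A\<^esub> (c (x, y) \<otimes>\<^bsub>A\<^esub> c (x \<otimes> y, x))"
    unfolding 1 2 [symmetric] by (simp add: A.m_ac)
  finally show ?thesis unfolding 3 .
qed

theorem lemma5p18:
  fixes G :: "('g, 'm) monoid_scheme" (structure)
    and a b :: 'g
    and C :: "'g \<times> 'g \<Rightarrow> int"
  assumes "dihedral_group_8 G a b"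
    and "C \<in> CM_domain G a \<rightarrow> carrier mu2"
    and "\<And>j::nat. j \<le> 3 \<Longrightarrow> C (a [^] (2::nat), a [^] j) = 1"
    and "\<And>j::nat. j \<le> 3 \<Longrightarrow> C (a [^] (2::nat), a [^] j \<otimes> b) = -1"
    and "\<And>y. y \<in> carrier G \<Longrightarrow> C (y, a [^] (2::nat)) = 1"
    and "\<And>y. y \<in> carrier G \<Longrightarrow> C (\<one>, y) = 1"
    and "\<And>y. y \<in> carrier G \<Longrightarrow> C (y, \<one>) = 1"
  shows "\<not> (\<exists>c. two_cocycle G mu2 c \<and> (\<forall>p \<in> CM_domain G a. c p = C p))"
proof
  assume "\<exists>c. two_cocycle G mu2 c \<and> (\<forall>p \<in> CM_domain G a. c p = C p)"
  then obtain c where c: "two_cocycle G mu2 c" and ext: "\<And>p. p \<in> CM_domain G a \<Longrightarrow> c p = C p"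
    by blast
  interpret dihedral_group_8 G a b by fact
  interpret c: two_cocycle G mu2 c by fact
  have a2: "a [^] (2::nat) = a \<otimes> a" by (simp add: numeral_2_eq_2)
  \<comment> \<open>Signs square to 1, which removes the values at \<open>(a, a)\<close>,
    \<open>(a, b)\<close> and \<open>(ab, a)\<close>, where nothing is prescribed.\<close>
  have sq: "c (x, y) * c (x, y) = 1" if "x \<in> carrier G" "y \<in> carrier G" for x y
    using c.value_closed[OF that] by (auto simp: sign_img_def)
  have "a \<otimes> b \<otimes> a = b"
    by (simp add: m_assoc b_a) (simp add: m_assoc [symmetric])
  from c.cocycle_square_sandwich[OF a_closed b_closed this]
  have "(c (a, a) * c (a, a)) * (c (a \<otimes> a, b) * c (a \<otimes> a \<otimes> b, a \<otimes> a)) =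
    (c (a, b) * c (a, b)) * (c (a \<otimes> b, a) * c (a \<otimes> b, a))"
    by (simp add: sign_img_def mult_ac)
  then have "c (a \<otimes> a, b) * c (a \<otimes> a \<otimes> b, a \<otimes> a) = 1"
    by (simp add: sq)
  \<comment> \<open>The case \<open>j = 0\<close> of the prescribed values, as \<open>b\<close>
    equals \<open>a [^] 0 \<otimes> b\<close>.\<close>
  moreover have "c (a \<otimes> a, b) = -1"
    using ext[of "(a \<otimes> a, b)"] assms(4)[of 0]
    by (simp add: CM_domain_def a2 generate.incl)
  moreover have "c (a \<otimes> a \<otimes> b, a \<otimes> a) = 1"
    using ext[of "(a \<otimes> a \<otimes> b, a \<otimes> a)"] assms(5)[of "a \<otimes> a \<otimes> b"]
    by (simp add: CM_domain_def a2 generate.incl)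
  ultimately show False by simp
qed

end
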